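(* Let $\mathcal{E}$ be an ellipse with semi-axes $a,b>0$. For every point $M$ on $\mathcal{E}$, the signed area $A^*$ of the hybrid pedal curve $\mathcal{E}^*$ of $\mathcal{E}$ with respect to $M$ does not depend on $M$ and is given by $$A^*=\frac{\pi(3a^4+2a^2b^2+3b^4)}{2ab}=\frac{\pi(3\delta^2+5a^2b^2)}{2ab},\qquad \delta=\sqrt{a^4-a^2b^2+b^4}.$$
   Context: Parametrize $\mathcal{E}$ by $P(t)=(a\cos t,b\sin t)$, $t\in[0,2\pi]$. Given $M$, let $\mathcal{L}(t)$ be the line through $P(t)$ perpendicular to $P(t)-M$, and let $Q_p(t)$ be the foot of the perpendicular dropped from $M$ onto the tangent line to $\mathcal{E}$ at $P(t)$. The hybrid pedal curve $\mathcal{E}^*$ of $\mathcal{E}$ with respect to $M$ is the locus of the intersection $Q^*(t)$ of $\mathcal{L}(t)$ with the line $MQ_p(t)$, i.e. with the line through $M$ perpendicular to $P'(t)$. When $M$ lies on $\mathcal{E}$, $Q^*(t)$ is defined at the single parameter value with $P(t)=M$ by continuity. The signed area of a closed parametrized curve $\gamma$ is $\frac12\int_\gamma(x\,dy-y\,dx)$, with orientation given by increasing $t$. *)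

theory Defs
  imports "HOL-Analysis.Analysis"
begin

definition ellipse :: "real \<Rightarrow> real \<Rightarrow> (real \<times> real) set" where
  "ellipse a b = {(x, y). x\<^sup>2 / a\<^sup>2 + y\<^sup>2 / b\<^sup>2 = 1}"

definition ellipse_point :: "real \<Rightarrow> real \<Rightarrow> real \<Rightarrow> real \<times> real" where
  "ellipse_point a b t = (a * cos t, b * sin t)"

definition ellipse_velocity :: "real \<Rightarrow> real \<Rightarrow> real \<Rightarrow> real \<times> real" where
  "ellipse_velocity a b t = vector_derivative (ellipse_point a b) (at t)"

(* The line through X perpendicular to v (for v \<noteq> 0). *)
definition perp_line :: "real \<times> real \<Rightarrow> real \<times> real \<Rightarrow> (real \<times> real) set" where
  "perp_line X v = {Y. (Y - X) \<bullet> v = 0}"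

(* Intersection of the line through P(t) perpendicular to P(t) - M with the line through M
   perpendicular to P'(t). The latter is the line joining M to the foot of the perpendicular from M
   to the tangent at P(t) whenever that foot differs from M, see perp_line_eq_line_through_foot. *)
definition hybrid_pedal_point :: "real \<Rightarrow> real \<Rightarrow> real \<times> real \<Rightarrow> real \<Rightarrow> real \<times> real" where
  "hybrid_pedal_point a b M t =
     (THE X. X \<in> perp_line (ellipse_point a b t) (ellipse_point a b t - M) \<inter>
                 perp_line M (ellipse_velocity a b t))"

(* Parametrized by t in [0, 2 pi]; extended by continuity where P(t) = M. When M = (a, 0), this
   happens at both ends of the interval, hence the limit within it. *)
definition hybrid_pedal :: "real \<Rightarrow> real \<Rightarrow> real \<times> real \<Rightarrow> real \<Rightarrow> real \<times> real" where
  "hybrid_pedal a b M t =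
     (if ellipse_point a b t = M
      then Lim (at t within {0..2 * pi}) (hybrid_pedal_point a b M)
      else hybrid_pedal_point a b M t)"

(* Half the integral of x dy - y dx over a closed curve parametrized by [0, 2 pi]. *)
definition signed_area :: "(real \<Rightarrow> real \<times> real) \<Rightarrow> real" where
  "signed_area \<gamma> =
     1 / 2 * integral {0..2 * pi}
       (\<lambda>t. let \<gamma>' = vector_derivative \<gamma> (at t within {0..2 * pi})
            in fst (\<gamma> t) * snd \<gamma>' - snd (\<gamma> t) * fst \<gamma>')"

text \<open>The rest of this theory shows that these definitions are meaningful: the velocity is the expected
  one, the two lines meet in exactly one point, and the extended curve is closed and
  continuously differentiable.\<close>

lemma ellipse_velocity_eq: "ellipse_velocity a b t = (- a * sin t, b * cos t)"
proof -
  have "((\<lambda>t. (a * cos t, b * sin t)) has_vector_derivative (- a * sin t, b * cos t)) (at t)"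
    by (intro has_vector_derivative_Pair)
       (auto intro!: derivative_eq_intros simp: has_real_derivative_iff_has_vector_derivative [symmetric])
  then show ?thesis
    unfolding ellipse_velocity_def ellipse_point_def [abs_def]
    by (rule vector_derivative_at)
qed

lemma perp_line_eq_line_through_foot:
  assumes tangent: "F = ellipse_point a b t + c *\<^sub>R ellipse_velocity a b t"
    and perp: "(F - M) \<bullet> ellipse_velocity a b t = 0"
    and "ellipse_velocity a b t \<noteq> 0" "F \<noteq> M"
  shows "affine hull {M, F} = perp_line M (ellipse_velocity a b t)"
proof -
  obtain v1 v2 where v: "ellipse_velocity a b t = (v1, v2)" by force
  obtain d1 d2 where d: "F - M = (d1, d2)" by force
  obtain m1 m2 where m: "M = (m1, m2)" by force
  have F: "F = (m1 + d1, m2 + d2)" using d m by (cases F) auto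
  have dv: "d1 * v1 + d2 * v2 = 0" using perp v d by (simp add: inner_prod_def)
  have dd: "d1\<^sup>2 + d2\<^sup>2 \<noteq> 0" using \<open>F \<noteq> M\<close> F m by (auto simp: sum_power2_eq_zero_iff)
  have vv: "v1 \<noteq> 0 \<or> v2 \<noteq> 0" using assms(3) v by (auto simp: zero_prod_def)
  show ?thesis
  proof (intro set_eqI iffI)
    fix X assume "X \<in> affine hull {M, F}"
    then obtain p q where "X = p *\<^sub>R M + q *\<^sub>R F" "p + q = 1"
      by (auto simp: affine_hull_2)
    then have "X - M = q *\<^sub>R (F - M)"
      by (simp add: algebra_simps flip: scaleR_add_left)
    then show "X \<in> perp_line M (ellipse_velocity a b t)"
      using perp by (simp add: perp_line_def)
  next
    fix X assume X: "X \<in> perp_line M (ellipse_velocity a b t)"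
    obtain e1 e2 where e: "X - M = (e1, e2)" by force
    have Xe: "X = (m1 + e1, m2 + e2)" using e m by (cases X) auto
    have ev: "e1 * v1 + e2 * v2 = 0"
      using X unfolding perp_line_def mem_Collect_eq e v by (simp add: inner_prod_def)
    have "(e1 * d2 - e2 * d1) * v1 = 0" "(e1 * d2 - e2 * d1) * v2 = 0"
      using ev dv by algebra+
    then have par: "e1 * d2 = e2 * d1" using vv by auto
    define q where "q = (e1 * d1 + e2 * d2) / (d1\<^sup>2 + d2\<^sup>2)"
    have "q * d1 = e1" "q * d2 = e2"
      using dd par unfolding q_def by (simp_all add: field_simps power2_eq_square)
    then have "X = (1 - q) *\<^sub>R M + q *\<^sub>R F"
      by (simp add: m F Xe algebra_simps)
    then show "X \<in> affine hull {M, F}"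
      unfolding affine_hull_2 using diff_add_cancel [of 1 q] by blast
  qed
qed

(* Closed form for M = P(s). By the half-angle identity in ellipse_chord, |P(t) - M|^2 and
   a b - M \<bullet> (b cos t, a sin t) share the factor 1 - cos (t - s), which cancels. *)
definition hybrid_pedal_form :: "real \<Rightarrow> real \<Rightarrow> real \<Rightarrow> real \<Rightarrow> real \<times> real" where
  "hybrid_pedal_form a b s t =
     (let l = 2 * (a\<^sup>2 * (sin ((t + s) / 2))\<^sup>2 + b\<^sup>2 * (cos ((t + s) / 2))\<^sup>2) / (a * b)
      in (a * cos s + l * (b * cos t), b * sin s + l * (a * sin t)))"

lemma ellipse_chord:
  fixes a b s t :: real
  shows "(a * cos t - a * cos s)\<^sup>2 + (b * sin t - b * sin s)\<^sup>2 =
    2 * (a\<^sup>2 * (sin ((t + s) / 2))\<^sup>2 + b\<^sup>2 * (cos ((t + s) / 2))\<^sup>2) * (1 - cos (t - s))"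
proof -
  define u v where "u = (t + s) / 2" and "v = (t - s) / 2"
  have ts: "t = u + v" "s = u - v" by (auto simp: u_def v_def field_simps)
  have "t - s = 2 * v" by (simp add: v_def)
  then have "1 - cos (t - s) = 2 * (sin v)\<^sup>2" by (simp add: cos_double_sin)
  moreover have "a * cos t - a * cos s = - 2 * a * sin u * sin v"
    "b * sin t - b * sin s = 2 * b * cos u * sin v"
    by (simp_all add: ts cos_add cos_diff sin_add sin_diff algebra_simps)
  ultimately show ?thesis
    unfolding u_def [symmetric] by (simp only:) (simp add: power2_eq_square algebra_simps)
qed

lemma hybrid_pedal_unique:
  assumes "a > 0" "b > 0" "ellipse_point a b t \<noteq> ellipse_point a b s"
  shows "X \<in> perp_line (ellipse_point a b t) (ellipse_point a b t - ellipse_point a b s) \<inter>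
             perp_line (ellipse_point a b s) (ellipse_velocity a b t)
         \<longleftrightarrow> X = hybrid_pedal_form a b s t"
proof -
  obtain x y where X: "X = (x, y)" by force
  define ct st cs ss where "ct = cos t" and "st = sin t" and "cs = cos s" and "ss = sin s"
  define k where "k = 1 - cos (t - s)"
  define m where "m = 2 * (a\<^sup>2 * (sin ((t + s) / 2))\<^sup>2 + b\<^sup>2 * (cos ((t + s) / 2))\<^sup>2)"
  have k: "k = 1 - ct * cs - st * ss"
    by (simp add: k_def cos_diff ct_def st_def cs_def ss_def)
  have t1: "ct\<^sup>2 + st\<^sup>2 = 1" and s1: "cs\<^sup>2 + ss\<^sup>2 = 1"
    by (simp_all add: ct_def st_def cs_def ss_def)
  have chord: "(a * ct - a * cs)\<^sup>2 + (b * st - b * ss)\<^sup>2 = m * k"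
    using ellipse_chord [of a t s b] by (simp add: ct_def st_def cs_def ss_def m_def k_def)
  have k0: "k \<noteq> 0"
    using chord assms(3)
    by (auto simp: sum_power2_eq_zero_iff ellipse_point_def ct_def st_def cs_def ss_def)
  define p q where "p = x - a * cs" and "q = y - b * ss"
  have xy: "x = a * cs + p" "y = b * ss + q" by (simp_all add: p_def q_def)
  have form: "X = hybrid_pedal_form a b s t \<longleftrightarrow> a * p = m * ct \<and> b * q = m * st"
  proof -
    have "X = hybrid_pedal_form a b s t \<longleftrightarrow> p = m / (a * b) * (b * ct) \<and> q = m / (a * b) * (a * st)"
      unfolding X hybrid_pedal_form_def Let_def m_def [symmetric] ct_def [symmetric]
        st_def [symmetric] cs_def [symmetric] ss_def [symmetric] xy by simp
    then show ?thesis
      using assms(1,2) by (simp add: field_simps)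
  qed
  have lines: "X \<in> perp_line (ellipse_point a b t) (ellipse_point a b t - ellipse_point a b s) \<inter>
        perp_line (ellipse_point a b s) (ellipse_velocity a b t)
     \<longleftrightarrow> p * (a * ct - a * cs) + q * (b * st - b * ss) = m * k \<and> b * q * ct = a * p * st"
    unfolding chord [symmetric]
    by (simp add: X perp_line_def ellipse_point_def ellipse_velocity_eq inner_prod_def
        ct_def [symmetric] st_def [symmetric] cs_def [symmetric] ss_def [symmetric] xy)
       (auto simp: algebra_simps power2_eq_square)
  show ?thesis
    unfolding form lines
  proof (intro iffI conjI)
    assume h: "a * p = m * ct \<and> b * q = m * st"
    then show "b * q * ct = a * p * st" by simp
    have "p * (a * ct - a * cs) + q * (b * st - b * ss)
      = (a * p) * (ct - cs) + (b * q) * (st - ss)" by (simp add: algebra_simps)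
    also have "\<dots> = m * (ct\<^sup>2 + st\<^sup>2 - ct * cs - st * ss)"
      by (simp add: h algebra_simps power2_eq_square)
    finally show "p * (a * ct - a * cs) + q * (b * st - b * ss) = m * k"
      by (simp add: k t1)
  next
    assume h: "p * (a * ct - a * cs) + q * (b * st - b * ss) = m * k \<and> b * q * ct = a * p * st"
    define P Q where "P = a * p" and "Q = b * q"
    have h1: "P * (ct - cs) + Q * (st - ss) = m * k" and h2: "Q * ct = P * st"
      using h by (simp_all add: P_def Q_def algebra_simps)
    have "P * k = m * k * ct" "Q * k = m * k * st"
      using h1 h2 t1 k by algebra+
    then have "P = m * ct" "Q = m * st" using k0 by simp_all
    then show "a * p = m * ct" "b * q = m * st" by (simp_all add: P_def Q_def)
  qed
qed

lemma ellipse_point_eq_iff: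
  assumes "a > 0" "b > 0"
  shows "ellipse_point a b t = ellipse_point a b s \<longleftrightarrow> cos (t - s) = 1"
proof
  assume "ellipse_point a b t = ellipse_point a b s"
  then have "cos t = cos s" "sin t = sin s"
    using assms by (simp_all add: ellipse_point_def)
  then show "cos (t - s) = 1"
    by (simp add: cos_diff flip: power2_eq_square)
next
  assume "cos (t - s) = 1"
  then have "(a * cos t - a * cos s)\<^sup>2 + (b * sin t - b * sin s)\<^sup>2 = 0"
    by (simp add: ellipse_chord)
  then show "ellipse_point a b t = ellipse_point a b s"
    by (simp add: sum_power2_eq_zero_iff ellipse_point_def)
qed

lemma hybrid_pedal_eq_form:
  assumes "a > 0" "b > 0" "t \<in> {0..2 * pi}"
  shows "hybrid_pedal a b (ellipse_point a b s) t = hybrid_pedal_form a b s t"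
proof -
  define M where "M = ellipse_point a b s"
  have pt: "hybrid_pedal_point a b M r = hybrid_pedal_form a b s r" if "ellipse_point a b r \<noteq> M" for r
    unfolding hybrid_pedal_point_def
    using hybrid_pedal_unique [OF assms(1,2)] that by (simp add: M_def)
  show ?thesis
  proof (cases "ellipse_point a b t = M")
    case True
    have "ellipse_point a b r \<noteq> M" if "r \<noteq> t" "dist r t < 1" for r
    proof
      assume "ellipse_point a b r = M"
      then have "cos (r - t) = 1"
        using True ellipse_point_eq_iff [OF assms(1,2)] by metis
      then obtain n :: int where n: "r - t = of_int n * 2 * pi"
        using cos_one_2pi_int by auto
      with that have "n \<noteq> 0" by auto
      then have "1 \<le> \<bar>real_of_int n\<bar>" by linarith
      then have "2 * pi \<le> \<bar>real_of_int n\<bar> * (2 * pi)" by (simp add: mult_le_cancel_right1)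
      then have "2 * pi \<le> \<bar>r - t\<bar>" by (simp add: n abs_mult)
      with that pi_gt3 show False by (simp add: dist_real_def)
    qed
    then have ev: "\<forall>\<^sub>F r in at t within {0..2 * pi}.
        hybrid_pedal_form a b s r = hybrid_pedal_point a b M r"
      unfolding eventually_at by (intro exI [of _ 1]) (auto simp: pt)
    have "continuous (at t within {0..2 * pi}) (hybrid_pedal_form a b s)"
      unfolding hybrid_pedal_form_def Let_def
      using assms by (intro continuous_intros) auto
    then have "(hybrid_pedal_form a b s \<longlongrightarrow> hybrid_pedal_form a b s t) (at t within {0..2 * pi})"
      by (simp add: continuous_within)
    then have lim: "(hybrid_pedal_point a b M \<longlongrightarrow> hybrid_pedal_form a b s t) (at t within {0..2 * pi})"
      using ev by (rule Lim_transform_eventually)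
    have "at t within {0..2 * pi} \<noteq> bot"
      using assms(3) by (simp add: trivial_limit_within islimpt_Icc)
    then have "Lim (at t within {0..2 * pi}) (hybrid_pedal_point a b M) = hybrid_pedal_form a b s t"
      using lim by (rule tendsto_Lim)
    then show ?thesis using True by (simp add: hybrid_pedal_def M_def [symmetric])
  next
    case False
    then show ?thesis by (simp add: hybrid_pedal_def pt M_def [symmetric])
  qed
qed

lemma ellipse_eq_range:
  assumes "a > 0" "b > 0"
  shows "ellipse a b = ellipse_point a b ` {0..2 * pi}"
proof (intro set_eqI iffI)
  fix X assume "X \<in> ellipse a b"
  then obtain x y where X: "X = (x, y)" "(x / a)\<^sup>2 + (y / b)\<^sup>2 = 1"
    by (auto simp: ellipse_def power_divide)
  then obtain t where "0 \<le> t" "t < 2 * pi" "x / a = cos t" "y / b = sin t"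
    using sincos_total_2pi by metis
  then show "X \<in> ellipse_point a b ` {0..2 * pi}"
    using assms X by (intro image_eqI [of _ _ t]) (auto simp: ellipse_point_def field_simps)
next
  fix X assume "X \<in> ellipse_point a b ` {0..2 * pi}"
  then show "X \<in> ellipse a b"
    using assms by (auto simp: ellipse_point_def ellipse_def power_mult_distrib)
qed

lemma hybrid_pedal_closed_C1:
  assumes "a > 0" "b > 0" "M \<in> ellipse a b"
  shows "hybrid_pedal a b M 0 = hybrid_pedal a b M (2 * pi)"
    and "\<exists>\<gamma>'. continuous_on {0..2 * pi} \<gamma>' \<and>
           (\<forall>t\<in>{0..2 * pi}.
              (hybrid_pedal a b M has_vector_derivative \<gamma>' t) (at t within {0..2 * pi}))"
proof -
  obtain s where M: "M = ellipse_point a b s"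
    using assms ellipse_eq_range by auto
  note eq = hybrid_pedal_eq_form [OF assms(1,2), of _ s, folded M]
  have "(2 * pi + s) / 2 = s / 2 + pi" by (simp add: field_simps)
  then have "hybrid_pedal_form a b s 0 = hybrid_pedal_form a b s (2 * pi)"
    unfolding hybrid_pedal_form_def Let_def by (simp only:) simp
  then show "hybrid_pedal a b M 0 = hybrid_pedal a b M (2 * pi)"
    by (simp add: eq)
  define l where "l = (\<lambda>t. 2 * (a\<^sup>2 * (sin ((t + s) / 2))\<^sup>2 + b\<^sup>2 * (cos ((t + s) / 2))\<^sup>2) / (a * b))"
  have form: "hybrid_pedal_form a b s =
      (\<lambda>t. (a * cos s + l t * (b * cos t), b * sin s + l t * (a * sin t)))"
    by (simp add: fun_eq_iff hybrid_pedal_form_def l_def)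
  define l' where "l' = (\<lambda>t. 2 * (a\<^sup>2 - b\<^sup>2) * sin ((t + s) / 2) * cos ((t + s) / 2) / (a * b))"
  define \<gamma>' where "\<gamma>' = (\<lambda>t. (l' t * (b * cos t) - l t * (b * sin t),
                              l' t * (a * sin t) + l t * (a * cos t)))"
  have l: "(l has_real_derivative l' t) (at t within A)" for t A
    unfolding l_def l'_def using assms
    by (auto intro!: derivative_eq_intros simp: field_simps)
  have "(hybrid_pedal_form a b s has_vector_derivative \<gamma>' t) (at t within {0..2 * pi})" for t
    unfolding form \<gamma>'_def
    by (intro has_vector_derivative_Pair)
       (auto intro!: derivative_eq_intros l
          simp: algebra_simps has_real_derivative_iff_has_vector_derivative [symmetric])
  note der = this
  have "(hybrid_pedal a b M has_vector_derivative \<gamma>' t) (at t within {0..2 * pi})"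
    if "t \<in> {0..2 * pi}" for t
    by (rule has_vector_derivative_transform [OF that _ der [of t]]) (rule eq)
  moreover have "continuous_on {0..2 * pi} \<gamma>'"
    unfolding \<gamma>'_def l_def l'_def using assms by (intro continuous_intros) auto
  ultimately show "\<exists>\<gamma>'. continuous_on {0..2 * pi} \<gamma>' \<and>
      (\<forall>t\<in>{0..2 * pi}. (hybrid_pedal a b M has_vector_derivative \<gamma>' t) (at t within {0..2 * pi}))"
    by blast
qed

end

theory Submission
  imports Defs
begin

text \<open>Write \<open>M = (a cos s, b sin s)\<close>. The hybrid pedal curve is then
  \<open>M + l(t) (b cos t, a sin t)\<close> with
  \<open>l(t) = (a\<^sup>2 + b\<^sup>2 - (a\<^sup>2 - b\<^sup>2) cos (t + s)) / (a b)\<close>: up to the translation by \<open>M\<close>, the ellipse with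
  semi-axes \<open>b\<close> and \<open>a\<close>, rescaled by the factor \<open>l(t)\<close>. The signed area of a closed curve does
  not change under translations (\<open>signed_area_translate\<close>), so \<open>M\<close> enters only through \<open>l\<close>. For a
  rescaled curve the derivative of the factor drops out of \<open>x dy - y dx\<close>, which leaves
  \<open>a b l(t)\<^sup>2 dt\<close> (\<open>signed_area_scaled_ellipse\<close>). In \<open>l\<close> the parameter \<open>s\<close> only
  shifts the phase, and over a full period this shift is invisible: the area is
  \<open>(1 / (2 a b)) \<integral> (a\<^sup>2 + b\<^sup>2 - (a\<^sup>2 - b\<^sup>2) cos \<theta>)\<^sup>2 d\<theta>\<close>, whose integral is
  \<open>\<pi> (2 (a\<^sup>2 + b\<^sup>2)\<^sup>2 + (a\<^sup>2 - b\<^sup>2)\<^sup>2)\<close>. This accounts for the independence of \<open>M\<close> and for the value.\<close>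

text \<open>Moving the origin by \<open>(p, q)\<close> changes \<open>x dy - y dx\<close> by the exact form \<open>p dv - q du\<close>, which
  integrates to zero along a closed curve.\<close>

lemma signed_area_translate:
  fixes u v u' v' :: "real \<Rightarrow> real"
  assumes curve: "\<And>t. t \<in> {0..2 * pi} \<Longrightarrow> \<gamma> t = (p + u t, q + v t)"
    and u: "\<And>t. t \<in> {0..2 * pi} \<Longrightarrow> (u has_real_derivative u' t) (at t within {0..2 * pi})"
    and v: "\<And>t. t \<in> {0..2 * pi} \<Longrightarrow> (v has_real_derivative v' t) (at t within {0..2 * pi})"
    and closed: "u 0 = u (2 * pi)" "v 0 = v (2 * pi)"
    and I: "((\<lambda>t. u t * v' t - v t * u' t) has_integral I) {0..2 * pi}"
  shows "signed_area \<gamma> = I / 2"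
proof -
  have der: "vector_derivative \<gamma> (at t within {0..2 * pi}) = (u' t, v' t)"
    if t: "t \<in> {0..2 * pi}" for t
  proof -
    have "((\<lambda>t. (p + u t, q + v t)) has_vector_derivative (u' t, v' t)) (at t within {0..2 * pi})"
      using u [OF t] v [OF t]
      by (intro has_vector_derivative_Pair)
         (auto intro!: derivative_eq_intros
            simp: has_real_derivative_iff_has_vector_derivative [symmetric])
    then have "(\<gamma> has_vector_derivative (u' t, v' t)) (at t within {0..2 * pi})"
      by (rule has_vector_derivative_transform [OF t curve, rotated])
    then show ?thesis
      using t by (intro vector_derivative_within_closed_interval) auto
  qed
  have "((\<lambda>t. p * v' t - q * u' t) has_integral
      (p * v (2 * pi) - q * u (2 * pi)) - (p * v 0 - q * u 0)) {0..2 * pi}"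
    by (intro fundamental_theorem_of_calculus)
       (auto intro!: derivative_eq_intros u v
          simp: has_real_derivative_iff_has_vector_derivative [symmetric])
  then have "((\<lambda>t. p * v' t - q * u' t) has_integral 0) {0..2 * pi}"
    by (simp add: closed)
  from has_integral_add [OF I this]
  have "((\<lambda>t. (p + u t) * v' t - (q + v t) * u' t) has_integral I) {0..2 * pi}"
    by (simp add: algebra_simps)
  then have "((\<lambda>t. let \<gamma>' = vector_derivative \<gamma> (at t within {0..2 * pi})
            in fst (\<gamma> t) * snd \<gamma>' - snd (\<gamma> t) * fst \<gamma>') has_integral I) {0..2 * pi}"
    by (rule has_integral_eq [rotated]) (simp add: der curve)
  then show ?thesis
    by (simp add: signed_area_def integral_unique)
qed

text \<open>The derivative of the factor \<open>l\<close> contributes multiples of the position vector, which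
  \<open>x dy - y dx\<close> annihilates, and the unscaled ellipse contributes the constant \<open>c d\<close>.\<close>

lemma signed_area_scaled_ellipse:
  fixes l l' :: "real \<Rightarrow> real"
  assumes curve: "\<And>t. t \<in> {0..2 * pi} \<Longrightarrow> \<gamma> t = (p + l t * (c * cos t), q + l t * (d * sin t))"
    and l: "\<And>t. t \<in> {0..2 * pi} \<Longrightarrow> (l has_real_derivative l' t) (at t within {0..2 * pi})"
    and closed: "l 0 = l (2 * pi)"
    and I: "((\<lambda>t. (l t)\<^sup>2) has_integral I) {0..2 * pi}"
  shows "signed_area \<gamma> = c * d * I / 2"
proof (rule signed_area_translate [OF curve])
  show "((\<lambda>t. l t * (c * cos t)) has_real_derivative l' t * (c * cos t) - l t * (c * sin t))
      (at t within {0..2 * pi})" if "t \<in> {0..2 * pi}" for t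
    by (rule derivative_eq_intros l [OF that] refl)+ (simp add: algebra_simps)
  show "((\<lambda>t. l t * (d * sin t)) has_real_derivative l' t * (d * sin t) + l t * (d * cos t))
      (at t within {0..2 * pi})" if "t \<in> {0..2 * pi}" for t
    by (rule derivative_eq_intros l [OF that] refl)+ (simp add: algebra_simps)
  have "l t * (c * cos t) * (l' t * (d * sin t) + l t * (d * cos t)) -
      l t * (d * sin t) * (l' t * (c * cos t) - l t * (c * sin t)) = c * d * (l t)\<^sup>2" for t
  proof -
    have "l t * (c * cos t) * (l' t * (d * sin t) + l t * (d * cos t)) -
        l t * (d * sin t) * (l' t * (c * cos t) - l t * (c * sin t))
        = c * d * (l t)\<^sup>2 * ((cos t)\<^sup>2 + (sin t)\<^sup>2)"
      by algebra
    then show ?thesis by simp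
  qed
  then show "((\<lambda>t. l t * (c * cos t) * (l' t * (d * sin t) + l t * (d * cos t)) -
      l t * (d * sin t) * (l' t * (c * cos t) - l t * (c * sin t))) has_integral c * d * I)
      {0..2 * pi}"
    using has_integral_mult_right [OF I, of "c * d"] by simp
qed (simp_all add: closed)

lemma has_integral_cos_affine_squared:
  fixes A B s :: real
  shows "((\<lambda>t. (A - B * cos (t + s))\<^sup>2) has_integral pi * (2 * A\<^sup>2 + B\<^sup>2)) {0..2 * pi}"
proof -
  define F where "F = (\<lambda>t. (A\<^sup>2 + B\<^sup>2 / 2) * t - 2 * A * B * sin (t + s)
    + B\<^sup>2 / 2 * (sin (t + s) * cos (t + s)))"
  have "(F has_real_derivative (A - B * cos (t + s))\<^sup>2) (at t within {0..2 * pi})" for t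
  proof -
    have "(F has_real_derivative (A\<^sup>2 + B\<^sup>2 / 2) - 2 * A * B * cos (t + s)
        + B\<^sup>2 / 2 * ((cos (t + s))\<^sup>2 - (sin (t + s))\<^sup>2)) (at t within {0..2 * pi})"
      unfolding F_def by (auto intro!: derivative_eq_intros simp: power2_eq_square)
    moreover have "(A\<^sup>2 + B\<^sup>2 / 2) - 2 * A * B * cos (t + s)
        + B\<^sup>2 / 2 * ((cos (t + s))\<^sup>2 - (sin (t + s))\<^sup>2) = (A - B * cos (t + s))\<^sup>2"
      by (simp add: sin_squared_eq power2_diff power_mult_distrib field_simps)
    ultimately show ?thesis by simp
  qed
  then have "((\<lambda>t. (A - B * cos (t + s))\<^sup>2) has_integral F (2 * pi) - F 0) {0..2 * pi}"
    by (intro fundamental_theorem_of_calculus)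
       (auto simp: has_real_derivative_iff_has_vector_derivative [symmetric])
  moreover have "F (2 * pi) - F 0 = pi * (2 * A\<^sup>2 + B\<^sup>2)"
    by (simp add: F_def sin_add cos_add algebra_simps)
  ultimately show ?thesis by simp
qed

text \<open>Doubling the angle turns the quadratic factor of the closed form into an affine function of
  \<open>cos (t + s)\<close>.\<close>

lemma hybrid_pedal_form_cos:
  fixes a b s t :: real
  defines "l \<equiv> (a\<^sup>2 + b\<^sup>2 - (a\<^sup>2 - b\<^sup>2) * cos (t + s)) / (a * b)"
  shows "hybrid_pedal_form a b s t = (a * cos s + l * (b * cos t), b * sin s + l * (a * sin t))"
proof -
  have "2 * ((t + s) / 2) = t + s"
    by simp
  then have c: "cos (t + s) = 2 * (cos ((t + s) / 2))\<^sup>2 - 1"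
    by (metis cos_double_cos)
  have "2 * (a\<^sup>2 * (sin ((t + s) / 2))\<^sup>2 + b\<^sup>2 * (cos ((t + s) / 2))\<^sup>2)
      = a\<^sup>2 + b\<^sup>2 - (a\<^sup>2 - b\<^sup>2) * cos (t + s)"
    unfolding c sin_squared_eq by (simp add: algebra_simps)
  then show ?thesis
    by (simp add: hybrid_pedal_form_def l_def)
qed

theorem theorem2:
  fixes a b \<delta> :: real and M :: "real \<times> real"
  assumes "a > 0" and "b > 0"
    and "\<delta> = sqrt (a^4 - a\<^sup>2 * b\<^sup>2 + b^4)"
    and "M \<in> ellipse a b"
  shows "signed_area (hybrid_pedal a b M) = pi * (3 * a^4 + 2 * a\<^sup>2 * b\<^sup>2 + 3 * b^4) / (2 * a * b)
       \<and> signed_area (hybrid_pedal a b M) = pi * (3 * \<delta>\<^sup>2 + 5 * a\<^sup>2 * b\<^sup>2) / (2 * a * b)"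
proof -
  obtain s where M: "M = ellipse_point a b s"
    using assms ellipse_eq_range by auto
  define A B where "A = a\<^sup>2 + b\<^sup>2" and "B = a\<^sup>2 - b\<^sup>2"
  define l where "l = (\<lambda>t. (A - B * cos (t + s)) / (a * b))"
  have "signed_area (hybrid_pedal a b M) = b * a * (pi * (2 * A\<^sup>2 + B\<^sup>2) / (a * b)\<^sup>2) / 2"
  proof (rule signed_area_scaled_ellipse)
    show "hybrid_pedal a b M t = (a * cos s + l t * (b * cos t), b * sin s + l t * (a * sin t))"
      if "t \<in> {0..2 * pi}" for t
      by (simp add: M hybrid_pedal_eq_form [OF assms(1,2) that] hybrid_pedal_form_cos
          l_def A_def B_def)
    show "(l has_real_derivative B * sin (t + s) / (a * b)) (at t within {0..2 * pi})" for t
      unfolding l_def using assms(1,2) by (auto intro!: derivative_eq_intros)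
    show "l 0 = l (2 * pi)"
      by (simp add: l_def cos_add)
    show "((\<lambda>t. (l t)\<^sup>2) has_integral pi * (2 * A\<^sup>2 + B\<^sup>2) / (a * b)\<^sup>2) {0..2 * pi}"
      unfolding l_def power_divide
      by (intro has_integral_divide has_integral_cos_affine_squared)
  qed
  also have "\<dots> = pi * (2 * A\<^sup>2 + B\<^sup>2) / (2 * a * b)"
    using assms(1,2) by (simp add: power2_eq_square)
  also have "2 * A\<^sup>2 + B\<^sup>2 = 3 * a^4 + 2 * a\<^sup>2 * b\<^sup>2 + 3 * b^4"
    unfolding A_def B_def by algebra
  finally have area: "signed_area (hybrid_pedal a b M)
      = pi * (3 * a^4 + 2 * a\<^sup>2 * b\<^sup>2 + 3 * b^4) / (2 * a * b)" .
  \<comment> \<open>The square root squares back because its radicand is \<open>(a\<^sup>2 - b\<^sup>2)\<^sup>2 + a\<^sup>2 b\<^sup>2\<close>.\<close>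
  have "a^4 - a\<^sup>2 * b\<^sup>2 + b^4 = (a\<^sup>2 - b\<^sup>2)\<^sup>2 + (a * b)\<^sup>2"
    by algebra
  then have "a^4 - a\<^sup>2 * b\<^sup>2 + b^4 \<ge> 0"
    by simp
  then have "\<delta>\<^sup>2 = a^4 - a\<^sup>2 * b\<^sup>2 + b^4"
    by (simp add: assms(3))
  then have "3 * \<delta>\<^sup>2 + 5 * a\<^sup>2 * b\<^sup>2 = 3 * a^4 + 2 * a\<^sup>2 * b\<^sup>2 + 3 * b^4"
    by simp
  then show ?thesis
    using area by simp
qed

end
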